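(* Let $f(z)=\sum_{k=0}^{\infty}c_kz^k$, $c_k\in\mathbb{C}$, be any formal power series, and let $m,n\ge 0$ be integers. Let $Q_1(z)$ be the first essential polynomial of the sequence $c_{m-n+1},\ldots,c_{m+n}$ (the parts of the statement that refer to $Q_1$ presuppose, as the definition of $Q_1$ does, that this sequence is non-zero). Then the following statements hold for the (reduced) $(m,n)$ Pade approximant $f_{m,n}(z)=P_{m,n}(z)/Q_{m,n}(z)$ of $f$. 1. The $(m,n)$ Pade approximant exists and is unique. 2. The denominator $Q_{m,n}(z)$ of the Pade approximant is unique up to a constant factor, and $Q_{m,n}(z)$ is the first essential polynomial $Q_1(z)$ of the sequence $c_{m-n+1},\ldots,c_{m+n}$. 3. $P_{m,n}(z)$ and $Q_{m,n}(z)$ have no common non-zero roots. 4. The $(m,n)$ Pade–Baker approximant of $f$ exists if and only if $Q_1(0)\ne 0$. The reduced Pade approximant $f_{m,n}(z)$ is the Pade–Baker approximant if the latter exists. 5. If $Q_1(z)$ has the root $z=0$ of order $\delta_{m,n}>0$, then $$f(z)-f_{m,n}(z)=Az^{m+n+1-\delta_{m,n}}+Bz^{m+n+2-\delta_{m,n}}+\cdots,\qquad A\ne 0.$$ (The number $\delta_{m,n}$ is called the deficiency index of the Pade approximant.)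
   Context: Convention: $c_k=0$ for $k<0$. Reduced Pade approximant. The (reduced) $(m,n)$ Pade approximant of $f$ is the rational function $f_{m,n}(z)=P_{m,n}(z)/Q_{m,n}(z)$, where $P_{m,n},Q_{m,n}$ are complex polynomials such that: (1) $Q_{m,n}\not\equiv 0$, $\deg Q_{m,n}\le n$, $\deg P_{m,n}\le m$; (2) $f(z)Q_{m,n}(z)-P_{m,n}(z)=r_{m+n+1}z^{m+n+1}+r_{m+n+2}z^{m+n+2}+\cdots$; (3) $Q_{m,n}$ has the minimal degree among all polynomials satisfying (1) and (2). Then $Q_{m,n}$ is called the denominator and $P_{m,n}$ the corresponding numerator. Pade–Baker approximant. If there are polynomials $P,Q$ satisfying (1) and (2) with $Q(0)\ne 0$, so that $f(z)-P(z)/Q(z)=R_{m+n+1}z^{m+n+1}+R_{m+n+2}z^{m+n+2}+\cdots$, then the rational function $P(z)/Q(z)$ is called the $(m,n)$ Pade–Baker approximant of $f$; it need not exist. First essential polynomial. Let $c_{m-n+1},\ldots,c_{m+n}$ be a non-zero sequence. Define a linear functional $\sigma$ by $\sigma\{z^j\}=c_{-j}$, $-m-n\le j\le -m+n-1$. A polynomial has formal degree $d$ if its degree is at most $d$. For $m-n+1\le k\le m+n$ let $\mathcal{N}_k$ be the space of complex polynomials $Q(z)$ of formal degree $k-m+n-1$ (including zero) such that $\sigma\{z^{-i}Q(z)\}=0$ for $i=k,k+1,\ldots,m+n$. Put $\mathcal{N}_{m-n}=0$ and let $\mathcal{N}_{m+n+1}$ be the $(2n+1)$-dimensional space of all polynomials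 of formal degree $2n$. Let $\Delta_k=\dim\mathcal{N}_k-\dim\mathcal{N}_{k-1}$ for $m-n+1\le k\le m+n+1$; it is known that $0=\Delta_{m-n+1}\le\Delta_{m-n+2}\le\cdots\le\Delta_{m+n+1}=2$. The first essential index $\mu_1$ is the largest $k$ with $\Delta_k=0$. The subspace $\mathcal{N}_{\mu_1}+z\mathcal{N}_{\mu_1}$ has codimension $1$ in $\mathcal{N}_{\mu_1+1}$, and a first essential polynomial $Q_1(z)$ of the sequence is any polynomial forming a basis of a one-dimensional complement of this subspace in $\mathcal{N}_{\mu_1+1}$ (it is determined up to a non-zero constant factor). *)

theory Defs
  imports "HOL-Computational_Algebra.Computational_Algebra"
begin

interpretation cpoly: vector_space "smult :: complex \<Rightarrow> complex poly \<Rightarrow> complex poly"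
  by unfold_locales (simp_all add: smult_add_left smult_add_right)

definition fps_coeff_int :: "complex fps \<Rightarrow> int \<Rightarrow> complex" where
  "fps_coeff_int f k = (if k < 0 then 0 else fps_nth f (nat k))"


text \<open>
  Conditions (1) and (2) on a pair of polynomials; ``formal degree'' bounds are meaningful because
  the zero polynomial has degree \<open>0\<close> in the library.
\<close>

definition pade_pair :: "complex fps \<Rightarrow> nat \<Rightarrow> nat \<Rightarrow> complex poly \<Rightarrow> complex poly \<Rightarrow> bool" where
  "pade_pair f m n P Q \<longleftrightarrow>
     Q \<noteq> 0 \<and> degree Q \<le> n \<and> degree P \<le> m \<and>
     (\<forall>j\<le>m + n. fps_nth (f * fps_of_poly Q - fps_of_poly P) j = 0)"

definition reduced_pade_pair ::
    "complex fps \<Rightarrow> nat \<Rightarrow> nat \<Rightarrow> complex poly \<Rightarrow> complex poly \<Rightarrow> bool" where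
  "reduced_pade_pair f m n P Q \<longleftrightarrow>
     pade_pair f m n P Q \<and> (\<forall>P' Q'. pade_pair f m n P' Q' \<longrightarrow> degree Q \<le> degree Q')"

definition pade_denominator :: "complex fps \<Rightarrow> nat \<Rightarrow> nat \<Rightarrow> complex poly \<Rightarrow> bool" where
  "pade_denominator f m n Q \<longleftrightarrow> (\<exists>P. reduced_pade_pair f m n P Q)"

definition pade_approximant :: "complex fps \<Rightarrow> nat \<Rightarrow> nat \<Rightarrow> complex poly fract \<Rightarrow> bool" where
  "pade_approximant f m n r \<longleftrightarrow> (\<exists>P Q. reduced_pade_pair f m n P Q \<and> r = Fract P Q)"

definition pade_baker_approximant :: "complex fps \<Rightarrow> nat \<Rightarrow> nat \<Rightarrow> complex poly fract \<Rightarrow> bool" where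
  "pade_baker_approximant f m n r \<longleftrightarrow>
     (\<exists>P Q. pade_pair f m n P Q \<and> poly Q 0 \<noteq> 0 \<and> r = Fract P Q)"


text \<open>
  In the following, \<open>c\<close> is indexed by all integers, but only the entries
  \<open>c (m - n + 1), \<dots>, c (m + n)\<close> are ever used; the indices may be negative.
\<close>

definition nonzero_seq :: "(int \<Rightarrow> complex) \<Rightarrow> nat \<Rightarrow> nat \<Rightarrow> bool" where
  "nonzero_seq c m n \<longleftrightarrow> (\<exists>k\<in>{int m - int n + 1..int m + int n}. c k \<noteq> 0)"

text \<open>
  The linear functional with \<open>\<sigma>{z\<^sup>j} = c\<^bsub>-j\<^esub>\<close> for
  \<open>-m - n \<le> j \<le> -m + n - 1\<close>. It is meant for Laurent polynomials supported in this range
  and simply ignores all other coefficients of a Laurent series.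
\<close>

definition sigma :: "(int \<Rightarrow> complex) \<Rightarrow> nat \<Rightarrow> nat \<Rightarrow> complex fls \<Rightarrow> complex" where
  "sigma c m n g = (\<Sum>j = - int m - int n..- int m + int n - 1. fls_nth g j * c (- j))"

lemma sigma_monomial:
  assumes "- int m - int n \<le> j" "j \<le> - int m + int n - 1"
  shows "sigma c m n (fls_X_intpow j) = c (- j)"
proof -
  have "sigma c m n (fls_X_intpow j) =
      (\<Sum>i = - int m - int n..- int m + int n - 1. if i = j then c (- i) else 0)"
    unfolding sigma_def by (rule sum.cong) auto
  then show ?thesis
    using assms by simp
qed

definition ess_space :: "(int \<Rightarrow> complex) \<Rightarrow> nat \<Rightarrow> nat \<Rightarrow> int \<Rightarrow> complex poly set" where
  "ess_space c m n k =
     (if k \<le> int m - int n then {0}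
      else if k \<le> int m + int n then
        {Q. int (degree Q) \<le> k - int m + int n - 1 \<and>
            (\<forall>i\<in>{k..int m + int n}.
               sigma c m n (fls_X_intpow (- i) * fps_to_fls (fps_of_poly Q)) = 0)}
      else {Q. degree Q \<le> 2 * n})"

definition ess_Delta :: "(int \<Rightarrow> complex) \<Rightarrow> nat \<Rightarrow> nat \<Rightarrow> int \<Rightarrow> int" where
  "ess_Delta c m n k =
     int (cpoly.dim (ess_space c m n k)) - int (cpoly.dim (ess_space c m n (k - 1)))"

text \<open>The maximum is over a non-empty set as soon as \<open>nonzero_seq c m n\<close> holds.\<close>

definition first_ess_index :: "(int \<Rightarrow> complex) \<Rightarrow> nat \<Rightarrow> nat \<Rightarrow> int" where
  "first_ess_index c m n =
     Max {k \<in> {int m - int n + 1..int m + int n + 1}. ess_Delta c m n k = 0}"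

definition first_ess_poly :: "(int \<Rightarrow> complex) \<Rightarrow> nat \<Rightarrow> nat \<Rightarrow> complex poly \<Rightarrow> bool" where
  "first_ess_poly c m n Q1 \<longleftrightarrow>
     (let \<mu> = first_ess_index c m n;
          W = {p + [:0, 1:] * q | p q. p \<in> ess_space c m n \<mu> \<and> q \<in> ess_space c m n \<mu>}
      in Q1 \<noteq> 0 \<and> W \<inter> cpoly.span {Q1} = {0} \<and>
         {w + v | w v. w \<in> W \<and> v \<in> cpoly.span {Q1}} = ess_space c m n (\<mu> + 1))"

end

theory Submission
  imports Defs
begin

text \<open>
  Call \<open>(P, Q)\<close> with \<open>Q \<noteq> 0\<close> a Pade pair if the degrees are at most \<open>m\<close> and \<open>n\<close> and \<open>f Q - P\<close> is
  divisible by \<open>z\<^bsup>m+n+1\<^esup>\<close>. Such pairs exist because \<open>Q\<close> has \<open>n + 1\<close> free coefficients subject to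
  \<open>n\<close> homogeneous equations, after which \<open>P\<close> is a truncation of \<open>f Q\<close>.

  Everything rests on one observation, \<open>reduced_pade_pair_generates\<close>: if the degree of \<open>Q\<close> is minimal,
  then every Pade pair has the form \<open>(P h, Q h)\<close>. Two Pade pairs always satisfy \<open>P Q' = P' Q\<close>, and
  division with remainder of \<open>Q'\<close> by \<open>Q\<close> would produce a Pade pair with smaller denominator degree unless the
  remainder vanishes. Uniqueness of the approximant and of the denominator up to constants follows at once,
  as does the criterion \<open>Q(0) \<noteq> 0\<close> for Pade--Baker approximants.

  Minimality also says which common factors can be cancelled. Cancelling \<open>z - a\<close> with \<open>a \<noteq> 0\<close> costs
  nothing, so there is no common non-zero root. Cancelling \<open>z\<close> costs one order of approximation; if \<open>Q(0) = 0\<close>,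
  that this is impossible means that \<open>f Q - P\<close> has order exactly \<open>m + n + 1\<close>, and division by \<open>Q\<close> gives
  the deficient order of the error.

  For the first essential polynomial, the functional turns the conditions defining the space
  \<open>N\<^sub>k\<close> into the vanishing of the coefficients of \<open>f Q\<close> from \<open>z\<^sup>k\<close> to \<open>z\<^bsup>m+n\<^esup>\<close>
  (\<open>sigma_eq_fps_coeff_int\<close>). When \<open>n > 0\<close>, the space \<open>N\<^bsub>m+1\<^esub>\<close> consists of \<open>0\<close> and the Pade
  denominators. Hence for \<open>k \<le> m + 1\<close> the elements of \<open>N\<^sub>k\<close> are those multiples \<open>Q h\<close> for which
  \<open>h\<close> has small enough degree: the spaces are \<open>0\<close> below some level \<open>\<kappa>\<close>, and at \<open>\<kappa>\<close> the
  space is the line spanned by \<open>Q\<close> (\<open>ess_space_below_and_at_pade_level\<close>). Beyond \<open>\<kappa>\<close> the dimensions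
  increase strictly because of multiplication by \<open>z\<close>. Therefore the first essential index is \<open>\<kappa> - 1\<close>, and
  the first essential polynomial is a non-zero multiple of \<open>Q\<close>.
\<close>

section \<open>Linear algebra on polynomials of bounded degree\<close>

text \<open>
  The type of polynomials is infinite-dimensional, so finiteness enters through a finite set \<open>W\<close>
  spanning the larger space: a basis of \<open>U\<close> enlarged by a vector outside \<open>U\<close> extends to a finite
  basis of \<open>V\<close>.
\<close>

lemma (in vector_space) dim_less_of_psubset:
  assumes "subspace U" "U \<subset> V" "V \<subseteq> span W" "finite W"
  shows "dim U < dim V"
proof -
  obtain B where B: "B \<subseteq> U" "independent B" "U \<subseteq> span B" "card B = dim U"
    using basis_exists by blast
  obtain x where x: "x \<in> V" "x \<notin> U"
    using assms(2) by blast
  have "x \<notin> span B"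
    using x B(1) assms(1) span_minimal by blast
  then have indep: "independent (insert x B)" "x \<notin> B"
    using B(2) independent_insertI span_base by blast+
  obtain C where C: "insert x B \<subseteq> C" "C \<subseteq> V" "independent C" "V \<subseteq> span C"
    using maximal_independent_subset_extend[of "insert x B" V] indep x B(1) assms(2) by blast
  have "finite C"
    using independent_span_bound[OF assms(4) C(3)] C(2) assms(3) by blast
  moreover have "B \<subset> C"
    using C(1) indep(2) by blast
  ultimately have "card B < card C"
    by (rule psubset_card_mono)
  then show ?thesis
    using B(4) basis_card_eq_dim[OF C(2,4,3)] by simp
qed

text \<open>
  All essential spaces consist of polynomials of bounded degree; this finitely generated space is where
  their dimensions are compared.
\<close>

lemma bounded_degree_subset_span_monoms:
  "{Q. degree Q \<le> d} \<subseteq> cpoly.span ((\<lambda>i. monom 1 i) ` {..d})"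
proof clarify
  fix Q :: "complex poly"
  assume "degree Q \<le> d"
  then have "Q = (\<Sum>i\<le>d. smult (coeff Q i) (monom 1 i))"
    by (simp add: poly_as_sum_of_monoms' smult_monom)
  also have "\<dots> \<in> cpoly.span ((\<lambda>i. monom 1 i) ` {..d})"
    by (intro cpoly.span_sum cpoly.span_scale cpoly.span_base) auto
  finally show "Q \<in> cpoly.span ((\<lambda>i. monom 1 i) ` {..d})" .
qed

text \<open>
  Gaussian elimination, organised by degrees. Let \<open>q\<close> have least degree \<open>d\<close> among the elements of \<open>S\<close>
  that violate the equation. An element of degree other than \<open>d\<close> either satisfies the equation or has
  larger degree than \<open>q\<close>; in the latter case subtracting a multiple of \<open>q\<close> enforces the equation
  without changing the degree.
\<close>

lemma one_equation_loses_at_most_one_degree: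
  fixes S :: "complex poly set" and L :: "complex poly \<Rightarrow> complex"
  assumes S: "\<And>p q a. p \<in> S \<Longrightarrow> q \<in> S \<Longrightarrow> p - smult a q \<in> S"
    and L: "\<And>p q a. L (p - smult a q) = L p - a * L q"
  shows "\<exists>d. degree ` (S - {0}) \<subseteq> insert d (degree ` ({Q \<in> S. L Q = 0} - {0}))"
proof (cases "\<exists>q\<in>S. L q \<noteq> 0")
  case True
  then obtain q where q: "q \<in> S \<and> L q \<noteq> 0"
    and q_min: "\<And>p. p \<in> S \<and> L p \<noteq> 0 \<Longrightarrow> degree q \<le> degree p"
    using ex_has_least_nat[of "\<lambda>q. q \<in> S \<and> L q \<noteq> 0" _ degree] by metis
  have "degree p \<in> degree ` ({Q \<in> S. L Q = 0} - {0})"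
    if p: "p \<in> S" "p \<noteq> 0" "degree p \<noteq> degree q" for p
  proof (cases "L p = 0")
    case True
    then show ?thesis using p by auto
  next
    case False
    define r where "r = p - smult (L p / L q) q"
    have "degree (smult (L p / L q) q) < degree p"
      using q_min[of p] p False by (simp add: le_neq_implies_less)
    then have deg: "degree r = degree p" "degree p > 0"
      unfolding r_def using degree_add_eq_left[of "- smult (L p / L q) q" p] by auto
    moreover have "r \<in> S" "L r = 0"
      unfolding r_def using S[of p q] L[of p _ q] p q by auto
    moreover have "r \<noteq> 0"
      using deg by auto
    ultimately show ?thesis
      by (metis (mono_tags, lifting) DiffI image_eqI mem_Collect_eq singletonD)
  qed
  then show ?thesis by (intro exI[of _ "degree q"]) auto
qed auto

text \<open>
  The \<open>n + 1\<close> degrees \<open>0, \<dots>, n\<close> are available at the start, each of the \<open>n\<close> equations destroys at most one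
  of them, so one survives.
\<close>

lemma exists_common_zero_of_functionals:
  fixes L :: "nat \<Rightarrow> complex poly \<Rightarrow> complex"
  assumes L: "\<And>i p q a. L i (p - smult a q) = L i p - a * L i q"
  shows "\<exists>Q. Q \<noteq> 0 \<and> degree Q \<le> n \<and> (\<forall>i<n. L i Q = 0)"
proof -
  define S where "S k = {Q. degree Q \<le> n \<and> (\<forall>i<k. L i Q = 0)}" for k
  have fin: "finite (degree ` (S k - {0}))" for k
    by (rule finite_subset[of _ "{..n}"]) (auto simp: S_def)
  have "n + 1 \<le> card (degree ` (S k - {0})) + k" for k
  proof (induction k)
    case 0
    have "{..n} \<subseteq> degree ` (S 0 - {0})"
    proof
      fix d assume "d \<in> {..n}"
      then show "d \<in> degree ` (S 0 - {0})"
        by (intro image_eqI[of _ _ "monom 1 d"]) (auto simp: S_def degree_monom_eq)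
    qed
    from card_mono[OF fin this] show ?case by simp
  next
    case (Suc k)
    have closed: "p - smult a q \<in> S k" if "p \<in> S k" "q \<in> S k" for p q a
      using that L by (auto simp: S_def intro: degree_diff_le order_trans[OF degree_smult_le])
    have "{Q \<in> S k. L k Q = 0} = S (Suc k)"
      by (auto simp: S_def less_Suc_eq)
    then obtain d where "degree ` (S k - {0}) \<subseteq> insert d (degree ` (S (Suc k) - {0}))"
      using one_equation_loses_at_most_one_degree[of "S k" "L k"] closed L by auto
    then have "card (degree ` (S k - {0})) \<le> card (insert d (degree ` (S (Suc k) - {0})))"
      using fin by (intro card_mono) auto
    also have "\<dots> \<le> card (degree ` (S (Suc k) - {0})) + 1"
      by (simp add: card_insert_if fin)
    finally show ?case using Suc by simp
  qed
  from this[of n] have "degree ` (S n - {0}) \<noteq> {}"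
    by (intro notI) simp
  then show ?thesis
    unfolding S_def by auto
qed

section \<open>The structure of all Pade pairs\<close>

lemma fps_X_power_dvd_iff_nth:
  fixes g :: "'a::field fps"
  shows "fps_X ^ N dvd g \<longleftrightarrow> (\<forall>j<N. fps_nth g j = 0)"
proof
  assume "fps_X ^ N dvd g"
  then show "\<forall>j<N. fps_nth g j = 0"
    by (auto simp: fps_X_power_mult_nth elim!: dvdE)
next
  assume "\<forall>j<N. fps_nth g j = 0"
  then have "fps_cutoff N g = 0"
    by (simp add: fps_eq_iff)
  then have "g = fps_X ^ N * fps_shift N g"
    using fps_shift_cutoff'[of N g] by simp
  then show "fps_X ^ N dvd g" by (rule dvdI)
qed

text \<open>
  In this form the approximation condition is stable under differences and multiples, and units of the
  power series ring can be cancelled from it.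
\<close>

lemma pade_pair_iff_dvd:
  "pade_pair f m n P Q \<longleftrightarrow> Q \<noteq> 0 \<and> degree Q \<le> n \<and> degree P \<le> m \<and>
     fps_X ^ (m + n + 1) dvd f * fps_of_poly Q - fps_of_poly P"
  unfolding pade_pair_def fps_X_power_dvd_iff_nth by (simp add: less_Suc_eq_le)

text \<open>
  The numerator is forced to be the truncation of \<open>f * Q\<close> after \<open>z\<^sup>m\<close>, so only the \<open>n\<close> linear
  conditions on the coefficients of \<open>z\<^bsup>m+1\<^esup>, \<dots>, z\<^bsup>m+n\<^esup>\<close> remain.
\<close>

lemma pade_pair_of_denominator:
  assumes Q: "Q \<noteq> 0" "degree Q \<le> n"
    and gap: "\<And>j. m < j \<Longrightarrow> j \<le> m + n \<Longrightarrow> fps_nth (f * fps_of_poly Q) j = 0"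
  shows "\<exists>P. pade_pair f m n P Q"
proof
  let ?P = "truncate_fps (m + 1) (f * fps_of_poly Q)"
  have "fps_nth (f * fps_of_poly Q - fps_of_poly ?P) j = 0" if "j \<le> m + n" for j
    using that gap[of j] by (cases "j \<le> m") auto
  moreover have "degree ?P \<le> m"
    using degree_truncate_fps[of "m + 1"] by (simp add: less_Suc_eq_le)
  ultimately show "pade_pair f m n ?P Q"
    using Q unfolding pade_pair_def by blast
qed

lemma pade_pair_exists: "\<exists>P Q. pade_pair f m n P Q"
proof -
  have "fps_nth (f * fps_of_poly (p - smult a q)) k =
      fps_nth (f * fps_of_poly p) k - a * fps_nth (f * fps_of_poly q) k" for p q a k
  proof -
    have "f * fps_of_poly (p - smult a q) =
        f * fps_of_poly p - fps_const a * (f * fps_of_poly q)"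
      by (simp add: fps_of_poly_diff fps_of_poly_smult algebra_simps)
    then show ?thesis by simp
  qed
  then obtain Q where Q: "Q \<noteq> 0" "degree Q \<le> n"
    "\<And>i. i < n \<Longrightarrow> fps_nth (f * fps_of_poly Q) (m + 1 + i) = 0"
    using exists_common_zero_of_functionals
      [of "\<lambda>i Q. fps_nth (f * fps_of_poly Q) (m + 1 + i)" n]
    by auto
  have "fps_nth (f * fps_of_poly Q) j = 0" if "m < j" "j \<le> m + n" for j
    using Q(3)[of "j - (m + 1)"] that by simp
  then show ?thesis
    using pade_pair_of_denominator[OF Q(1,2)] by blast
qed

lemma reduced_pade_pair_exists: "\<exists>P Q. reduced_pade_pair f m n P Q"
proof -
  obtain P0 Q0 where "pade_pair f m n P0 Q0"
    using pade_pair_exists by blast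
  then have "\<exists>x. pade_pair f m n (fst x) (snd x) \<and>
      (\<forall>y. pade_pair f m n (fst y) (snd y) \<longrightarrow> degree (snd x) \<le> degree (snd y))"
    using ex_has_least_nat[of "\<lambda>x. pade_pair f m n (fst x) (snd x)" "(P0, Q0)" "\<lambda>x. degree (snd x)"]
    by simp
  then show ?thesis
    unfolding reduced_pade_pair_def by (metis fst_conv snd_conv)
qed

text \<open>
  \<open>P Q' - P' Q = Q (f Q' - P') - Q' (f Q - P)\<close> is divisible by \<open>z\<^bsup>m+n+1\<^esup>\<close>, yet a polynomial of
  degree at most \<open>m + n\<close>.
\<close>

lemma pade_pair_cross_mult:
  assumes "pade_pair f m n P Q" "pade_pair f m n P' Q'"
  shows "P * Q' = P' * Q"
proof -
  have "fps_of_poly (P * Q' - P' * Q) =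
      fps_of_poly Q * (f * fps_of_poly Q' - fps_of_poly P') -
      fps_of_poly Q' * (f * fps_of_poly Q - fps_of_poly P)"
    by (simp add: fps_of_poly_mult fps_of_poly_diff algebra_simps)
  also have "fps_X ^ (m + n + 1) dvd \<dots>"
    using assms unfolding pade_pair_iff_dvd by (intro dvd_diff[OF dvd_mult dvd_mult]) auto
  finally have low: "coeff (P * Q' - P' * Q) j = 0" if "j \<le> m + n" for j
    using that unfolding fps_X_power_dvd_iff_nth by auto
  have "degree (P * Q' - P' * Q) \<le> m + n"
    using assms unfolding pade_pair_def
    by (intro degree_diff_le order_trans[OF degree_mult_le]) auto
  then have "P * Q' - P' * Q = 0"
    using low by (metis leading_coeff_0_iff)
  then show ?thesis by simp
qed

text \<open>
  The key structural fact. Divide \<open>Q'\<close> by \<open>Q\<close> with quotient \<open>h\<close> and remainder \<open>R\<close>, and subtract \<open>h\<close>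
  times the reduced pair from the given one. The result \<open>(S, R)\<close> still satisfies the approximation
  condition, and \<open>S Q = P R\<close> bounds the degree of \<open>S\<close> by that of \<open>P\<close>. If \<open>R\<close> were non-zero,
  \<open>(S, R)\<close> would be a Pade pair whose denominator has smaller degree than \<open>Q\<close>.
\<close>

lemma reduced_pade_pair_generates:
  assumes red: "reduced_pade_pair f m n P Q" and pair: "pade_pair f m n P' Q'"
  obtains h where "P' = P * h" "Q' = Q * h" "h \<noteq> 0"
proof -
  have pade: "pade_pair f m n P Q"
    and least: "\<And>P' Q'. pade_pair f m n P' Q' \<Longrightarrow> degree Q \<le> degree Q'"
    using red unfolding reduced_pade_pair_def by auto
  have Q: "Q \<noteq> 0" using pade unfolding pade_pair_def by blast
  define h R S where "h = Q' div Q" and "R = Q' mod Q" and "S = P' - P * h"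
  have Q'_eq: "Q' = Q * h + R" unfolding h_def R_def by simp
  have S_R: "S * Q = P * R"
    using pade_pair_cross_mult[OF pade pair] unfolding S_def Q'_eq by (simp add: algebra_simps)
  have "R = 0"
  proof (rule ccontr)
    assume R: "R \<noteq> 0"
    then have deg_R: "degree R < degree Q"
      unfolding R_def using degree_mod_less[of Q Q'] Q by blast
    have "degree S \<le> degree P"
    proof (cases "S = 0")
      case False
      then have "P \<noteq> 0" using S_R Q by auto
      then have "degree S + degree Q = degree P + degree R"
        using arg_cong[OF S_R, of degree] False Q R by (simp add: degree_mult_eq)
      then show ?thesis using deg_R by simp
    qed simp
    moreover have "f * fps_of_poly R - fps_of_poly S =
        (f * fps_of_poly Q' - fps_of_poly P') - fps_of_poly h * (f * fps_of_poly Q - fps_of_poly P)"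
      unfolding Q'_eq S_def by (simp add: fps_of_poly_mult fps_of_poly_diff fps_of_poly_add algebra_simps)
    moreover have "fps_X ^ (m + n + 1) dvd \<dots>"
      using pade pair unfolding pade_pair_iff_dvd by (intro dvd_diff[OF _ dvd_mult]) auto
    ultimately have "pade_pair f m n S R"
      using pade deg_R R unfolding pade_pair_iff_dvd by auto
    then show False using least[of S R] deg_R by simp
  qed
  then have "S = 0" using S_R Q by simp
  show thesis
  proof
    show "P' = P * h" using \<open>S = 0\<close> unfolding S_def by simp
    show "Q' = Q * h" using \<open>R = 0\<close> Q'_eq by simp
    then show "h \<noteq> 0" using pair unfolding pade_pair_def by auto
  qed
qed

lemma pade_pair_smult:
  assumes "pade_pair f m n P Q" "a \<noteq> 0"
  shows "pade_pair f m n (smult a P) (smult a Q)"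
proof -
  have "f * fps_of_poly (smult a Q) - fps_of_poly (smult a P) =
      fps_const a * (f * fps_of_poly Q - fps_of_poly P)"
    by (simp add: fps_of_poly_smult algebra_simps)
  then show ?thesis
    using assms unfolding pade_pair_iff_dvd by (metis degree_smult_eq dvd_mult smult_eq_0_iff)
qed

lemma reduced_pade_pair_unique:
  assumes red: "reduced_pade_pair f m n P Q"
  shows "reduced_pade_pair f m n P' Q' \<longleftrightarrow> (\<exists>a. a \<noteq> 0 \<and> P' = smult a P \<and> Q' = smult a Q)"
proof
  assume red': "reduced_pade_pair f m n P' Q'"
  then obtain h where h: "P' = P * h" "Q' = Q * h" "h \<noteq> 0"
    using reduced_pade_pair_generates[OF red] unfolding reduced_pade_pair_def by blast
  have "Q \<noteq> 0" "degree Q' \<le> degree Q"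
    using red red' unfolding reduced_pade_pair_def pade_pair_def by auto
  then have "degree h = 0"
    using h by (simp add: degree_mult_eq)
  then obtain a where "h = [:a:]" by (rule degree_eq_zeroE)
  then show "\<exists>a. a \<noteq> 0 \<and> P' = smult a P \<and> Q' = smult a Q"
    using h by auto
next
  assume "\<exists>a. a \<noteq> 0 \<and> P' = smult a P \<and> Q' = smult a Q"
  then show "reduced_pade_pair f m n P' Q'"
    using red pade_pair_smult unfolding reduced_pade_pair_def by auto
qed

lemma pade_denominator_iff:
  assumes "reduced_pade_pair f m n P Q"
  shows "pade_denominator f m n Q' \<longleftrightarrow> (\<exists>a. a \<noteq> 0 \<and> Q' = smult a Q)"
  unfolding pade_denominator_def reduced_pade_pair_unique[OF assms] by blast

lemma pade_pair_fract:
  assumes red: "reduced_pade_pair f m n P Q" and pair: "pade_pair f m n P' Q'"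
  shows "Fract P' Q' = Fract P Q"
  using pade_pair_cross_mult[of f m n P Q P' Q'] assms
  unfolding reduced_pade_pair_def pade_pair_def
  by (simp add: eq_fract(1) mult.commute)

text \<open>
  The linear factor of a non-zero root is a unit in the ring of power series, so as a common factor it
  could be cancelled without losing order of approximation, against minimality.
\<close>

lemma reduced_pade_pair_no_common_nonzero_root:
  assumes red: "reduced_pade_pair f m n P Q" and z: "z \<noteq> 0" "poly P z = 0"
  shows "poly Q z \<noteq> 0"
proof
  assume "poly Q z = 0"
  then obtain P' Q' where PQ: "P = [:- z, 1:] * P'" "Q = [:- z, 1:] * Q'"
    using z(2) by (meson dvdE poly_eq_0_iff_dvd)
  have pade: "pade_pair f m n P Q"
    using red unfolding reduced_pade_pair_def by blast
  then have Q': "Q' \<noteq> 0"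
    unfolding pade_pair_def PQ by auto
  have deg: "degree P' \<le> degree P" "degree Q = degree Q' + 1"
    unfolding PQ using Q' degree_mult_eq[of "[:- z, 1:]" P'] degree_mult_eq[of "[:- z, 1:]" Q']
    by (cases "P' = 0"; simp del: mult_pCons_left)+
  have "fps_of_poly [:- z, 1:] dvd 1"
    using z(1) by (simp add: fps_is_unit_iff)
  moreover have "f * fps_of_poly Q - fps_of_poly P =
      fps_of_poly [:- z, 1:] * (f * fps_of_poly Q' - fps_of_poly P')"
    unfolding PQ by (simp only: fps_of_poly_mult) (simp add: algebra_simps)
  ultimately have "fps_X ^ (m + n + 1) dvd f * fps_of_poly Q' - fps_of_poly P'"
    using pade unfolding pade_pair_iff_dvd by (metis dvd_mult_unit_iff')
  then have "pade_pair f m n P' Q'"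
    using pade deg Q' unfolding pade_pair_iff_dvd by auto
  then show False
    using red deg unfolding reduced_pade_pair_def by fastforce
qed

text \<open>
  If the error had one order more than required, then a factor \<open>z\<close> of \<open>Q\<close>, which \<open>P\<close> must share, could be
  cancelled: the order lost by cancelling is exactly the spare one. This contradicts minimality.
\<close>

lemma reduced_pade_pair_error_exact:
  assumes red: "reduced_pade_pair f m n P Q" and root: "poly Q 0 = 0"
  shows "fps_nth (f * fps_of_poly Q - fps_of_poly P) (m + n + 1) \<noteq> 0"
proof
  assume extra: "fps_nth (f * fps_of_poly Q - fps_of_poly P) (m + n + 1) = 0"
  have pade: "pade_pair f m n P Q"
    using red unfolding reduced_pade_pair_def by blast
  have zero: "fps_nth (f * fps_of_poly Q - fps_of_poly P) j = 0" if "j < m + n + 2" for j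
  proof (cases "j = m + n + 1")
    case False
    then show ?thesis using pade that unfolding pade_pair_def by simp
  qed (use extra in simp)
  have "coeff Q 0 = 0" using root by (simp add: poly_0_coeff_0)
  then have "coeff P 0 = 0" using zero[of 0] by simp
  with \<open>coeff Q 0 = 0\<close> obtain P' Q' where PQ: "P = pCons 0 P'" "Q = pCons 0 Q'"
    by (metis coeff_pCons_0 pCons_cases)
  have Q': "Q' \<noteq> 0"
    using pade unfolding pade_pair_def PQ by auto
  have "fps_X * (f * fps_of_poly Q' - fps_of_poly P') = f * fps_of_poly Q - fps_of_poly P"
    unfolding PQ by (simp add: fps_of_poly_pCons algebra_simps)
  then have "fps_nth (f * fps_of_poly Q' - fps_of_poly P') j = 0" if "j \<le> m + n" for j
    using zero[of "Suc j"] that by (metis fps_X_mult_nth add_2_eq_Suc' diff_Suc_1 less_Suc_eq_le nat.distinct(1) Suc_less_eq)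
  then have "pade_pair f m n P' Q'"
    using pade Q' unfolding pade_pair_def PQ by (auto split: if_splits simp: degree_pCons_eq_if)
  then have "degree Q \<le> degree Q'"
    using red unfolding reduced_pade_pair_def by blast
  then show False unfolding PQ using Q' by simp
qed

text \<open>
  Write \<open>Q = z\<^bsup>d\<^esup> q\<close> with \<open>q(0) \<noteq> 0\<close> and \<open>f Q - P = z\<^bsup>m+n+1\<^esup> G\<close> with \<open>G(0) \<noteq> 0\<close>. Then
  \<open>f - P/Q = z\<^bsup>m+n+1-d\<^esup> G/q\<close>.
\<close>

lemma pade_error_laurent:
  assumes red: "reduced_pade_pair f m n P Q" and pos: "order 0 Q > 0"
  shows "\<exists>g :: complex fps. fps_nth g 0 \<noteq> 0 \<and>
    fps_to_fls f - fps_to_fls (fps_of_poly P) / fps_to_fls (fps_of_poly Q) =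
      fls_X_intpow (int m + int n + 1 - int (order 0 Q)) * fps_to_fls g"
proof -
  have pade: "pade_pair f m n P Q"
    using red unfolding reduced_pade_pair_def by blast
  then have Q: "Q \<noteq> 0" unfolding pade_pair_def by blast
  define d where "d = order 0 Q"
  obtain q where q: "Q = [:0, 1:] ^ d * q" "\<not> [:0, 1:] dvd q"
    using order_decomp[OF Q, of 0] unfolding d_def by auto
  then have q0: "coeff q 0 \<noteq> 0"
    using poly_eq_0_iff_dvd[of q 0] by (simp add: poly_0_coeff_0)
  have fps_Q: "fps_of_poly Q = fps_X ^ d * fps_of_poly q"
    unfolding q(1) by (simp add: fps_of_poly_mult fps_of_poly_power)
  obtain G where G: "f * fps_of_poly Q - fps_of_poly P = fps_X ^ (m + n + 1) * G"
    using pade unfolding pade_pair_iff_dvd by (auto elim: dvdE)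
  have "poly Q 0 = 0"
    using pos Q by (simp add: order_root)
  then have "fps_nth G 0 \<noteq> 0"
    using reduced_pade_pair_error_exact[OF red] unfolding G
    by (simp add: fps_X_power_mult_nth del: power_Suc)
  define g where "g = G * inverse (fps_of_poly q)"
  have g0: "fps_nth g 0 \<noteq> 0"
    using \<open>fps_nth G 0 \<noteq> 0\<close> q0 unfolding g_def by simp
  have G_eq: "G = g * fps_of_poly q"
    unfolding g_def using q0 inverse_mult_eq_1[of "fps_of_poly q"] by (simp add: mult.assoc)
  have X: "fps_to_fls (fps_X ^ k) = (fls_X_intpow (int k) :: complex fls)" for k
    by (simp add: fps_to_fls_power fls_X_power_conv_shift_1)
  have nz: "fps_to_fls (fps_of_poly Q) \<noteq> 0"
    using Q by simp
  have "fps_to_fls f - fps_to_fls (fps_of_poly P) / fps_to_fls (fps_of_poly Q) =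
      fps_to_fls (f * fps_of_poly Q - fps_of_poly P) / fps_to_fls (fps_of_poly Q)"
    using nz by (simp add: fls_times_fps_to_fls diff_divide_distrib)
  also have "fps_to_fls (f * fps_of_poly Q - fps_of_poly P) =
      fls_X_intpow (int (m + n + 1)) * fps_to_fls g * fps_to_fls (fps_of_poly q)"
    unfolding G G_eq by (simp only: fls_times_fps_to_fls X mult.assoc)
  also have "fls_X_intpow (int (m + n + 1)) =
      (fls_X_intpow (int m + int n + 1 - int d) * fls_X_intpow (int d) :: complex fls)"
    by (simp only: fls_X_intpow_times_fls_X_intpow) (simp add: algebra_simps)
  also have "\<dots> * fps_to_fls g * fps_to_fls (fps_of_poly q) =
      fls_X_intpow (int m + int n + 1 - int d) * fps_to_fls g * fps_to_fls (fps_of_poly Q)"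
    unfolding fps_Q by (simp only: fls_times_fps_to_fls X mult_ac)
  also have "\<dots> / fps_to_fls (fps_of_poly Q) =
      fls_X_intpow (int m + int n + 1 - int d) * fps_to_fls g"
    using nz by (rule nonzero_mult_div_cancel_right)
  finally show ?thesis using g0 unfolding d_def by blast
qed

section \<open>The essential spaces and the first essential polynomial\<close>

lemma fps_coeff_int_mult_poly:
  "fps_coeff_int (f * fps_of_poly Q) i =
     (\<Sum>l\<le>degree Q. coeff Q l * fps_coeff_int f (i - int l))"
proof (cases "i < 0")
  case True
  then show ?thesis by (simp add: fps_coeff_int_def)
next
  case False
  define k where "k = nat i"
  have i: "i = int k" using False by (simp add: k_def)
  have "fps_nth (f * fps_of_poly Q) k = (\<Sum>l\<le>k. coeff Q l * fps_nth f (k - l))"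
    by (subst mult.commute) (simp add: fps_mult_nth atLeast0AtMost)
  also have "\<dots> = (\<Sum>l\<le>k. coeff Q l * fps_coeff_int f (i - int l))"
    by (intro sum.cong) (auto simp: fps_coeff_int_def i nat_diff_distrib')
  also have "\<dots> = (\<Sum>l\<le>max k (degree Q). coeff Q l * fps_coeff_int f (i - int l))"
    by (intro sum.mono_neutral_left) (auto simp: fps_coeff_int_def i)
  also have "\<dots> = (\<Sum>l\<le>degree Q. coeff Q l * fps_coeff_int f (i - int l))"
    by (intro sum.mono_neutral_right) (auto simp: coeff_eq_0)
  finally show ?thesis
    by (simp add: fps_coeff_int_def i)
qed

text \<open>
  The essential spaces are thereby about vanishing coefficients of \<open>f * Q\<close>. The hypotheses say that all
  indices with a contribution stay in the window on which \<open>sigma\<close> is defined: the degree bound controls its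
  upper end, the bound on \<open>i\<close> its lower end.
\<close>

lemma sigma_eq_fps_coeff_int:
  assumes "int (degree Q) \<le> i - int m + int n - 1" "i \<le> int m + int n"
  shows "sigma (fps_coeff_int f) m n (fls_X_intpow (- i) * fps_to_fls (fps_of_poly Q)) =
    fps_coeff_int (f * fps_of_poly Q) i"
proof -
  define t where "t j = fls_nth (fps_to_fls (fps_of_poly Q)) (j + i) * fps_coeff_int f (- j)" for j
  have t_shift: "t (int l - i) = coeff Q l * fps_coeff_int f (i - int l)" for l
    by (simp add: t_def)
  have "sigma (fps_coeff_int f) m n (fls_X_intpow (- i) * fps_to_fls (fps_of_poly Q)) =
      (\<Sum>j = - int m - int n..- int m + int n - 1. t j)"
    unfolding sigma_def fls_X_intpow_times_conv_shift t_def by simp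
  also have "\<dots> = (\<Sum>j\<in>(\<lambda>l. int l - i) ` {..degree Q}. t j)"
  proof (rule sum.mono_neutral_right)
    show "\<forall>j\<in>{- int m - int n..- int m + int n - 1} - (\<lambda>l. int l - i) ` {..degree Q}. t j = 0"
    proof
      fix j assume j: "j \<in> {- int m - int n..- int m + int n - 1} - (\<lambda>l. int l - i) ` {..degree Q}"
      show "t j = 0"
      proof (cases "j + i < 0")
        case False
        then have "j = int (nat (j + i)) - i" by simp
        then have "nat (j + i) \<notin> {..degree Q}" using j by blast
        then have "degree Q < nat (j + i)" by simp
        then show ?thesis using False by (simp add: t_def coeff_eq_0)
      qed (simp add: t_def)
    qed
  qed (use assms in auto)
  also have "\<dots> = (\<Sum>l\<le>degree Q. t (int l - i))"
    by (subst sum.reindex) (auto simp: inj_on_def)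
  finally show ?thesis
    unfolding t_shift fps_coeff_int_mult_poly .
qed

abbreviation series_ess_space :: "complex fps \<Rightarrow> nat \<Rightarrow> nat \<Rightarrow> int \<Rightarrow> complex poly set" where
  "series_ess_space f \<equiv> ess_space (fps_coeff_int f)"

lemma mem_ess_space_iff:
  assumes "int m - int n < k" "k \<le> int m + int n"
  shows "Q \<in> series_ess_space f m n k \<longleftrightarrow>
    int (degree Q) \<le> k - int m + int n - 1 \<and>
    (\<forall>i\<in>{k..int m + int n}. fps_coeff_int (f * fps_of_poly Q) i = 0)"
proof -
  have "sigma (fps_coeff_int f) m n (fls_X_intpow (- i) * fps_to_fls (fps_of_poly Q)) =
      fps_coeff_int (f * fps_of_poly Q) i"
    if "int (degree Q) \<le> k - int m + int n - 1" "i \<in> {k..int m + int n}" for i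
    using that by (intro sigma_eq_fps_coeff_int) auto
  then show ?thesis
    using assms by (simp add: ess_space_def cong: conj_cong)
qed

lemma ess_space_subspace: "cpoly.subspace (series_ess_space f m n k)"
proof -
  have sum0: "fps_coeff_int (f * fps_of_poly (p + q)) i =
      fps_coeff_int (f * fps_of_poly p) i + fps_coeff_int (f * fps_of_poly q) i" for p q i
    by (simp add: fps_coeff_int_def fps_of_poly_add algebra_simps)
  have smult0: "fps_coeff_int (f * fps_of_poly (smult a p)) i =
      a * fps_coeff_int (f * fps_of_poly p) i" for a p i
    by (simp add: fps_coeff_int_def fps_of_poly_smult mult.left_commute[of f])
  consider "k \<le> int m - int n" | "int m - int n < k" "k \<le> int m + int n" | "int m + int n < k"
    by linarith
  then show ?thesis
  proof cases
    case 2
    have "int (degree (p + q)) < d" if "int (degree p) < d" "int (degree q) < d"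
      for p q :: "complex poly" and d
      using degree_add_le_max[of p q] that by linarith
    moreover have "int (degree (smult a p)) < d" if "int (degree p) < d"
      for a and p :: "complex poly" and d
      using degree_smult_le[of a p] that by linarith
    ultimately show ?thesis
      using 2 by (auto simp: cpoly.subspace_def mem_ess_space_iff sum0 smult0)
        (auto simp: fps_coeff_int_def)
  next
    case 3
    then show ?thesis
      by (auto simp: cpoly.subspace_def ess_space_def intro: degree_add_le order_trans[OF degree_smult_le])
  qed (simp add: ess_space_def cpoly.subspace_def)
qed

lemma ess_space_bounded_degree: "series_ess_space f m n k \<subseteq> {Q. degree Q \<le> 2 * n}"
  by (auto simp: ess_space_def split: if_splits)

text \<open>
  Multiplication by \<open>z\<close> shifts the coefficients of \<open>f * Q\<close> by one, which matches the shift of the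
  conditions and of the degree bound from \<open>k - 1\<close> to \<open>k\<close>.
\<close>

lemma ess_space_mono_and_shift:
  assumes k: "k \<le> int m + int n + 1" and Q: "Q \<in> series_ess_space f m n (k - 1)"
  shows "Q \<in> series_ess_space f m n k" "pCons 0 Q \<in> series_ess_space f m n k"
proof -
  have "Q \<in> series_ess_space f m n k \<and> pCons 0 Q \<in> series_ess_space f m n k"
  proof (cases "k - 1 \<le> int m - int n")
    case True
    then have "Q = 0" using Q by (simp add: ess_space_def)
    then show ?thesis using cpoly.subspace_0[OF ess_space_subspace] by simp
  next
    case False
    then have Q': "int (degree Q) \<le> k - 1 - int m + int n - 1"
        "\<And>i. i \<in> {k - 1..int m + int n} \<Longrightarrow> fps_coeff_int (f * fps_of_poly Q) i = 0"
      using Q k mem_ess_space_iff[of m n "k - 1" Q f] by auto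
    have deg: "int (degree (pCons 0 Q)) \<le> int (degree Q) + 1"
      using degree_pCons_le[of 0 Q] by linarith
    have shift: "fps_coeff_int (f * fps_of_poly (pCons 0 Q)) i =
        fps_coeff_int (f * fps_of_poly Q) (i - 1)" for i
      by (auto simp: fps_coeff_int_def fps_of_poly_pCons mult.assoc[symmetric] nat_diff_distrib)
    show ?thesis
    proof (cases "k \<le> int m + int n")
      case True
      then show ?thesis
        using False Q' deg by (simp add: mem_ess_space_iff shift)
    next
      case False
      then show ?thesis
        using Q' deg k \<open>\<not> k - 1 \<le> int m - int n\<close> by (simp add: ess_space_def)
    qed
  qed
  then show "Q \<in> series_ess_space f m n k" "pCons 0 Q \<in> series_ess_space f m n k"
    by auto
qed

text \<open>
  For \<open>Q\<close> of largest degree in the smaller space, \<open>z Q\<close> lies in the next space but is too long for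
  the smaller one.
\<close>

lemma ess_Delta_pos:
  assumes k: "k \<le> int m + int n + 1" and ne: "series_ess_space f m n (k - 1) \<noteq> {0}"
  shows "ess_Delta (fps_coeff_int f) m n k > 0"
proof -
  let ?U = "series_ess_space f m n (k - 1)"
  have "0 \<in> ?U" using cpoly.subspace_0[OF ess_space_subspace] .
  then obtain Q0 where Q0: "Q0 \<in> ?U \<and> Q0 \<noteq> 0" using ne by blast
  moreover have "\<forall>R. R \<in> ?U \<and> R \<noteq> 0 \<longrightarrow> degree R \<le> 2 * n"
    using ess_space_bounded_degree[of f m n "k - 1"] by blast
  ultimately have "\<exists>Q. (Q \<in> ?U \<and> Q \<noteq> 0) \<and>
      (\<forall>R. R \<in> ?U \<and> R \<noteq> 0 \<longrightarrow> degree R \<le> degree Q)"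
    using ex_has_greatest_nat[of "\<lambda>R. R \<in> ?U \<and> R \<noteq> 0" Q0 degree "2 * n + 1"]
    by (simp add: less_Suc_eq_le)
  then obtain Q where Q: "Q \<in> ?U" "Q \<noteq> 0"
    and Q_max: "\<And>R. R \<in> ?U \<Longrightarrow> R \<noteq> 0 \<Longrightarrow> degree R \<le> degree Q"
    by blast
  have "pCons 0 Q \<notin> ?U"
    using Q_max[of "pCons 0 Q"] Q(2) by auto
  then have "?U \<subset> series_ess_space f m n k"
    using ess_space_mono_and_shift[OF k] Q(1) by blast
  then have "cpoly.dim ?U < cpoly.dim (series_ess_space f m n k)"
    by (rule cpoly.dim_less_of_psubset[OF ess_space_subspace _
        order_trans[OF ess_space_bounded_degree bounded_degree_subset_span_monoms]]) simp
  then show ?thesis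
    by (simp add: ess_Delta_def)
qed

text \<open>
  For a Pade pair with \<open>n > 0\<close>, the least index \<open>k\<close> for which \<open>Q\<close> belongs to the essential space
  \<open>N\<^sub>k\<close> (see \<open>pade_pair_mem_ess_space_iff\<close>): the denominator must respect the formal degree
  \<open>k - m + n - 1\<close>, and \<open>f * Q\<close>, which agrees with \<open>P\<close> up to \<open>z\<^bsup>m+n\<^esup>\<close>, must have no
  terms of degree \<open>k, \<dots>, m + n\<close>. The second requirement is void for \<open>P = 0\<close>, which the degree
  convention would otherwise misread as a constant.
\<close>

definition pade_level :: "nat \<Rightarrow> nat \<Rightarrow> complex poly \<Rightarrow> complex poly \<Rightarrow> int" where
  "pade_level m n P Q =
     (let d = int m - int n + 1 + int (degree Q)
      in if P = 0 then d else max d (int (degree P) + 1))"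

lemma pade_level_bounds:
  assumes "pade_pair f m n P Q"
  shows "int m - int n + 1 \<le> pade_level m n P Q" "pade_level m n P Q \<le> int m + 1"
  using assms by (auto simp: pade_level_def pade_pair_def Let_def)

lemma fps_coeff_int_pade:
  assumes "pade_pair f m n P Q" "0 \<le> i" "i \<le> int m + int n"
  shows "fps_coeff_int (f * fps_of_poly Q) i = coeff P (nat i)"
proof -
  have "nat i \<le> m + n" using assms by linarith
  then have "fps_nth (f * fps_of_poly Q - fps_of_poly P) (nat i) = 0"
    using assms(1) unfolding pade_pair_def by blast
  then show ?thesis using assms by (simp add: fps_coeff_int_def)
qed

lemma pade_pair_mem_ess_space_iff:
  assumes pade: "pade_pair f m n P Q" and k: "int m - int n < k" "k \<le> int m + int n"
  shows "Q \<in> series_ess_space f m n k \<longleftrightarrow> pade_level m n P Q \<le> k"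
proof -
  have "(\<forall>i\<in>{k..int m + int n}. fps_coeff_int (f * fps_of_poly Q) i = 0) \<longleftrightarrow>
      P = 0 \<or> int (degree P) < k"
  proof
    assume zero: "\<forall>i\<in>{k..int m + int n}. fps_coeff_int (f * fps_of_poly Q) i = 0"
    show "P = 0 \<or> int (degree P) < k"
    proof (rule ccontr)
      assume "\<not> (P = 0 \<or> int (degree P) < k)"
      then have "P \<noteq> 0" "k \<le> int (degree P)" by auto
      moreover have "int (degree P) \<le> int m + int n"
        using pade unfolding pade_pair_def by auto
      ultimately show False
        using zero fps_coeff_int_pade[OF pade, of "int (degree P)"] by simp
    qed
  next
    assume P: "P = 0 \<or> int (degree P) < k"
    show "\<forall>i\<in>{k..int m + int n}. fps_coeff_int (f * fps_of_poly Q) i = 0"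
    proof
      fix i assume i: "i \<in> {k..int m + int n}"
      show "fps_coeff_int (f * fps_of_poly Q) i = 0"
      proof (cases "i < 0")
        case False
        have "coeff P (nat i) = 0"
          using P i by (auto intro: coeff_eq_0)
        then show ?thesis using fps_coeff_int_pade[OF pade, of i] i False by simp
      qed (simp add: fps_coeff_int_def)
    qed
  qed
  then show ?thesis
    unfolding mem_ess_space_iff[OF k] pade_level_def by (auto simp: Let_def)
qed

lemma ess_space_imp_pade_pair:
  assumes k: "int m - int n < k" "k \<le> int m + 1" "k \<le> int m + int n"
    and Q: "Q \<in> series_ess_space f m n k" "Q \<noteq> 0"
  shows "\<exists>P. pade_pair f m n P Q"
proof -
  have Q': "int (degree Q) \<le> k - int m + int n - 1"
      "\<And>i. i \<in> {k..int m + int n} \<Longrightarrow> fps_coeff_int (f * fps_of_poly Q) i = 0"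
    using Q(1) unfolding mem_ess_space_iff[OF k(1,3)] by auto
  have "fps_nth (f * fps_of_poly Q) j = 0" if "m < j" "j \<le> m + n" for j
    using that Q'(2)[of "int j"] k by (simp add: fps_coeff_int_def)
  then show ?thesis
    using pade_pair_of_denominator[of Q n m f] Q(2) Q'(1) k by auto
qed

text \<open>
  Up to index \<open>m + 1\<close> every non-zero element of an essential space is a Pade denominator, hence a
  multiple \<open>Q h\<close> of the reduced one with numerator \<open>P h\<close>, and its level exceeds that of \<open>(P, Q)\<close>
  by \<open>degree h\<close>. So nothing appears below the level of \<open>(P, Q)\<close>, and at that level only constant
  \<open>h\<close> are possible.
\<close>

lemma ess_space_below_and_at_pade_level:
  assumes red: "reduced_pade_pair f m n P Q" and n: "n > 0"
  shows "k < pade_level m n P Q \<Longrightarrow> series_ess_space f m n k = {0}"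
    and "series_ess_space f m n (pade_level m n P Q) = cpoly.span {Q}"
proof -
  have pade: "pade_pair f m n P Q"
    using red unfolding reduced_pade_pair_def by blast
  then have Q: "Q \<noteq> 0" unfolding pade_pair_def by blast
  note bounds = pade_level_bounds[OF pade]
  have zero: "0 \<in> series_ess_space f m n k" for k
    using cpoly.subspace_0[OF ess_space_subspace] .
  have elem: "\<exists>h. Q' = Q * h \<and> h \<noteq> 0 \<and> pade_level m n P Q + int (degree h) \<le> k"
    if k: "int m - int n < k" "k \<le> int m + 1"
      and Q': "Q' \<in> series_ess_space f m n k" "Q' \<noteq> 0" for k Q'
  proof -
    have k': "k \<le> int m + int n" using k n by linarith
    obtain P' where pade': "pade_pair f m n P' Q'"
      using ess_space_imp_pade_pair[OF k k' Q'] by blast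
    then obtain h where h: "P' = P * h" "Q' = Q * h" "h \<noteq> 0"
      using reduced_pade_pair_generates[OF red] by blast
    have "pade_level m n P' Q' = pade_level m n P Q + int (degree h)"
      using h Q by (auto simp: pade_level_def Let_def degree_mult_eq)
    then show ?thesis
      using pade_pair_mem_ess_space_iff[OF pade' k(1) k'] Q'(1) h by auto
  qed
  show "series_ess_space f m n k = {0}" if less: "k < pade_level m n P Q" for k
  proof (cases "int m - int n < k")
    case True
    have "Q' = 0" if "Q' \<in> series_ess_space f m n k" for Q'
      using elem[OF True _ that] less bounds by fastforce
    then show ?thesis using zero by blast
  qed (simp add: ess_space_def)
  let ?N = "series_ess_space f m n (pade_level m n P Q)"
  have "Q \<in> ?N"
    using pade_pair_mem_ess_space_iff[OF pade, of "pade_level m n P Q"] bounds n by auto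
  moreover have "Q' \<in> cpoly.span {Q}" if mem: "Q' \<in> ?N" for Q'
  proof (cases "Q' = 0")
    case False
    then obtain h where h: "Q' = Q * h" "degree h = 0"
      using elem[of "pade_level m n P Q" Q'] mem bounds by auto
    then obtain a where "h = [:a:]" using degree_eq_zeroE by blast
    then show ?thesis using h by (auto simp: cpoly.span_singleton)
  qed (simp add: cpoly.span_zero)
  ultimately show "?N = cpoly.span {Q}"
    using cpoly.span_minimal[OF _ ess_space_subspace, of "{Q}"] by blast
qed

text \<open>
  Otherwise a non-zero constant lies in the first essential space, which forces the whole sequence to vanish.
  This places the index \<open>pade_level m n P Q - 1\<close> in the range over which the first essential index is a
  maximum.
\<close>

lemma pade_level_gt_of_nonzero_seq:
  assumes pade: "pade_pair f m n P Q" and nz: "nonzero_seq (fps_coeff_int f) m n"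
  shows "pade_level m n P Q > int m - int n + 1"
proof (rule ccontr)
  assume "\<not> ?thesis"
  then have eq: "pade_level m n P Q = int m - int n + 1"
    using pade_level_bounds[OF pade] by simp
  obtain k where k: "k \<in> {int m - int n + 1..int m + int n}" "fps_coeff_int f k \<noteq> 0"
    using nz unfolding nonzero_seq_def by blast
  then have "Q \<in> series_ess_space f m n (int m - int n + 1)"
    using pade_pair_mem_ess_space_iff[OF pade, of "int m - int n + 1"] eq by auto
  then have Q: "degree Q = 0" "fps_coeff_int (f * fps_of_poly Q) k = 0"
    using k mem_ess_space_iff[of m n "int m - int n + 1" Q f] by auto
  then have "coeff Q 0 \<noteq> 0"
    using pade leading_coeff_0_iff[of Q] unfolding pade_pair_def by metis
  then show False
    using Q k(2) by (simp add: fps_coeff_int_mult_poly)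
qed

text \<open>
  The spaces vanish up to this index, so the jump there is \<open>0\<close>; the next space is the line spanned by \<open>Q\<close>,
  and from then on the spaces are non-zero and grow strictly.
\<close>

lemma first_ess_index_eq_pade_level:
  assumes red: "reduced_pade_pair f m n P Q" and nz: "nonzero_seq (fps_coeff_int f) m n"
  shows "first_ess_index (fps_coeff_int f) m n = pade_level m n P Q - 1"
proof -
  have pade: "pade_pair f m n P Q"
    using red unfolding reduced_pade_pair_def by blast
  then have Q: "Q \<noteq> 0" unfolding pade_pair_def by blast
  have n: "n > 0" using nz unfolding nonzero_seq_def by (cases n) auto
  define \<kappa> where "\<kappa> = pade_level m n P Q"
  have bounds: "int m - int n + 1 < \<kappa>" "\<kappa> \<le> int m + 1"
    using pade_level_gt_of_nonzero_seq[OF pade nz] pade_level_bounds[OF pade] by (simp_all add: \<kappa>_def)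
  have below: "series_ess_space f m n k = {0}" if "k < \<kappa>" for k
    using ess_space_below_and_at_pade_level(1)[OF red n] that by (simp add: \<kappa>_def)
  have at: "series_ess_space f m n \<kappa> = cpoly.span {Q}"
    using ess_space_below_and_at_pade_level(2)[OF red n] by (simp add: \<kappa>_def)
  have Q_above: "Q \<in> series_ess_space f m n (\<kappa> + int j)" if "\<kappa> + int j \<le> int m + int n + 1" for j
    using that
  proof (induction j)
    case 0
    then show ?case using at cpoly.span_base[of Q "{Q}"] by simp
  next
    case (Suc j)
    then show ?case using ess_space_mono_and_shift(1)[of "\<kappa> + int (Suc j)" m n Q f] by simp
  qed
  have above: "ess_Delta (fps_coeff_int f) m n k \<noteq> 0" if k: "\<kappa> \<le> k" "k \<le> int m + int n + 1" for k
  proof (cases "k = \<kappa>")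
    case True
    have "cpoly.dim (cpoly.span {Q}) = 1"
      using cpoly.dim_span_eq_card_independent[of "{Q}"] Q by (simp add: cpoly.dependent_single)
    moreover have "cpoly.dim {0} = 0"
      using cpoly.dim_le_card[of "{0}" "{}"] by simp
    ultimately show ?thesis
      using below[of "\<kappa> - 1"] at by (simp add: ess_Delta_def True)
  next
    case False
    then have "Q \<in> series_ess_space f m n (k - 1)"
      using Q_above[of "nat (k - 1 - \<kappa>)"] k by simp
    then have "series_ess_space f m n (k - 1) \<noteq> {0}"
      using Q by auto
    then show ?thesis using ess_Delta_pos[of k m n f] k by simp
  qed
  have "ess_Delta (fps_coeff_int f) m n (\<kappa> - 1) = 0"
    by (simp add: ess_Delta_def below)
  then have "Max {k \<in> {int m - int n + 1..int m + int n + 1}.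
      ess_Delta (fps_coeff_int f) m n k = 0} = \<kappa> - 1"
    using bounds n
  proof (intro Max_eqI)
    show "finite {k \<in> {int m - int n + 1..int m + int n + 1}.
        ess_Delta (fps_coeff_int f) m n k = 0}"
      by (rule finite_subset[of _ "{int m - int n + 1..int m + int n + 1}"]) auto
  next
    fix k assume "k \<in> {k \<in> {int m - int n + 1..int m + int n + 1}.
        ess_Delta (fps_coeff_int f) m n k = 0}"
    then show "k \<le> \<kappa> - 1"
      using above[of k] by (cases "\<kappa> \<le> k") auto
  qed auto
  then show ?thesis
    by (simp add: first_ess_index_def \<kappa>_def)
qed

text \<open>
  The space at the first essential index is \<open>0\<close>, so the subspace to be complemented is trivial and the complement
  is the whole next space, the line spanned by \<open>Q\<close>.
\<close>

lemma first_ess_poly_iff: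
  assumes red: "reduced_pade_pair f m n P Q" and nz: "nonzero_seq (fps_coeff_int f) m n"
  shows "first_ess_poly (fps_coeff_int f) m n Q1 \<longleftrightarrow> (\<exists>a. a \<noteq> 0 \<and> Q1 = smult a Q)"
proof -
  have Q: "Q \<noteq> 0"
    using red unfolding reduced_pade_pair_def pade_pair_def by blast
  have n: "n > 0" using nz unfolding nonzero_seq_def by (cases n) auto
  have "series_ess_space f m n (pade_level m n P Q - 1) = {0}"
    using ess_space_below_and_at_pade_level(1)[OF red n] by simp
  then have "first_ess_poly (fps_coeff_int f) m n Q1 \<longleftrightarrow>
      Q1 \<noteq> 0 \<and> cpoly.span {Q1} = cpoly.span {Q}"
    unfolding first_ess_poly_def first_ess_index_eq_pade_level[OF red nz] Let_def
    using ess_space_below_and_at_pade_level(2)[OF red n] by (auto simp: cpoly.span_zero)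
  also have "\<dots> \<longleftrightarrow> (\<exists>a. a \<noteq> 0 \<and> Q1 = smult a Q)"
  proof
    assume "Q1 \<noteq> 0 \<and> cpoly.span {Q1} = cpoly.span {Q}"
    then show "\<exists>a. a \<noteq> 0 \<and> Q1 = smult a Q"
      using cpoly.span_base[of Q1 "{Q1}"] by (auto simp: cpoly.span_singleton)
  next
    assume "\<exists>a. a \<noteq> 0 \<and> Q1 = smult a Q"
    then obtain a where a: "a \<noteq> 0" "Q1 = smult a Q" by blast
    then have "Q = smult (inverse a) Q1" by simp
    then have "Q \<in> cpoly.span {Q1}" "Q1 \<in> cpoly.span {Q}"
      using a(2) by (auto simp: cpoly.span_singleton)
    then show "Q1 \<noteq> 0 \<and> cpoly.span {Q1} = cpoly.span {Q}"
      using a Q by (auto intro!: cpoly.span_eq[THEN iffD2])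
  qed
  finally show ?thesis .
qed

section \<open>Pade--Baker approximants and the properties of the Pade approximant\<close>

text \<open>
  \<open>Q\<close> divides the denominator of every Pade pair, so if \<open>Q\<close> vanishes at \<open>0\<close>, all of them do.
\<close>

lemma pade_baker_exists_iff:
  assumes red: "reduced_pade_pair f m n P Q"
  shows "(\<exists>r. pade_baker_approximant f m n r) \<longleftrightarrow> poly Q 0 \<noteq> 0"
proof
  assume "\<exists>r. pade_baker_approximant f m n r"
  then obtain P' Q' where "pade_pair f m n P' Q'" "poly Q' 0 \<noteq> 0"
    unfolding pade_baker_approximant_def by blast
  then show "poly Q 0 \<noteq> 0"
    using reduced_pade_pair_generates[OF red] by (metis mult_zero_left poly_mult)
next
  assume "poly Q 0 \<noteq> 0"
  then show "\<exists>r. pade_baker_approximant f m n r"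
    using red unfolding pade_baker_approximant_def reduced_pade_pair_def by blast
qed

theorem theorem4p1:
  fixes f :: "complex fps" and m n :: nat
  shows
    "(\<exists>!r. pade_approximant f m n r) \<and>
     (\<forall>Q. pade_denominator f m n Q \<longrightarrow>
        (\<forall>Q'. pade_denominator f m n Q' \<longleftrightarrow> (\<exists>a. a \<noteq> 0 \<and> Q' = smult a Q))) \<and>
     (nonzero_seq (fps_coeff_int f) m n \<longrightarrow>
        (\<forall>Q. pade_denominator f m n Q \<longleftrightarrow> first_ess_poly (fps_coeff_int f) m n Q)) \<and>
     (\<forall>P Q. reduced_pade_pair f m n P Q \<longrightarrow>
        \<not> (\<exists>z. z \<noteq> 0 \<and> poly P z = 0 \<and> poly Q z = 0)) \<and>
     (nonzero_seq (fps_coeff_int f) m n \<longrightarrow>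
        (\<forall>Q1. first_ess_poly (fps_coeff_int f) m n Q1 \<longrightarrow>
           ((\<exists>r. pade_baker_approximant f m n r) \<longleftrightarrow> poly Q1 0 \<noteq> 0))) \<and>
     (\<forall>r s. pade_approximant f m n r \<and> pade_baker_approximant f m n s \<longrightarrow> r = s) \<and>
     (nonzero_seq (fps_coeff_int f) m n \<longrightarrow>
        (\<forall>Q1 P Q \<delta>. first_ess_poly (fps_coeff_int f) m n Q1 \<and> reduced_pade_pair f m n P Q \<and>
             \<delta> = order 0 Q1 \<and> \<delta> > 0 \<longrightarrow>
           (\<exists>g :: complex fps. fps_nth g 0 \<noteq> 0 \<and>
              fps_to_fls f - fps_to_fls (fps_of_poly P) / fps_to_fls (fps_of_poly Q) =
                fls_X_intpow (int m + int n + 1 - int \<delta>) * fps_to_fls g)))"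
proof (intro conjI allI impI)
  obtain P Q where red: "reduced_pade_pair f m n P Q"
    using reduced_pade_pair_exists by blast
  show "\<exists>!r. pade_approximant f m n r"
  proof (rule ex1I[of _ "Fract P Q"])
    show "pade_approximant f m n (Fract P Q)"
      using red unfolding pade_approximant_def by blast
    show "r = Fract P Q" if "pade_approximant f m n r" for r
      using that pade_pair_fract[OF red]
      unfolding pade_approximant_def reduced_pade_pair_def by blast
  qed
  show "(\<exists>r. pade_baker_approximant f m n r) \<longleftrightarrow> poly Q1 0 \<noteq> 0"
    if "nonzero_seq (fps_coeff_int f) m n" "first_ess_poly (fps_coeff_int f) m n Q1" for Q1
    using pade_baker_exists_iff[OF red] first_ess_poly_iff[OF red that(1)] that(2) by auto
  show "pade_denominator f m n Q' \<longleftrightarrow> first_ess_poly (fps_coeff_int f) m n Q'"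
    if "nonzero_seq (fps_coeff_int f) m n" for Q'
    using pade_denominator_iff[OF red] first_ess_poly_iff[OF red that] by simp
next
  show "pade_denominator f m n Q' \<longleftrightarrow> (\<exists>a. a \<noteq> 0 \<and> Q' = smult a Q)"
    if "pade_denominator f m n Q" for Q Q'
    using that pade_denominator_iff unfolding pade_denominator_def[of f m n Q] by blast
  show "\<not> (\<exists>z. z \<noteq> 0 \<and> poly P z = 0 \<and> poly Q z = 0)" if "reduced_pade_pair f m n P Q" for P Q
    using reduced_pade_pair_no_common_nonzero_root[OF that] by blast
  show "r = s" if "pade_approximant f m n r \<and> pade_baker_approximant f m n s" for r s
    using that pade_pair_fract[of f m n]
    unfolding pade_approximant_def pade_baker_approximant_def by metis
  show "\<exists>g :: complex fps. fps_nth g 0 \<noteq> 0 \<and>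
      fps_to_fls f - fps_to_fls (fps_of_poly P) / fps_to_fls (fps_of_poly Q) =
        fls_X_intpow (int m + int n + 1 - int \<delta>) * fps_to_fls g"
    if nz: "nonzero_seq (fps_coeff_int f) m n"
      and "first_ess_poly (fps_coeff_int f) m n Q1 \<and> reduced_pade_pair f m n P Q \<and>
        \<delta> = order 0 Q1 \<and> \<delta> > 0" for Q1 P Q \<delta>
  proof -
    have red: "reduced_pade_pair f m n P Q" and "\<delta> = order 0 Q1" "\<delta> > 0"
      and "first_ess_poly (fps_coeff_int f) m n Q1"
      using that(2) by auto
    moreover have "order 0 Q1 = order 0 Q"
      using first_ess_poly_iff[OF red nz, of Q1] that(2) order_smult by blast
    ultimately show ?thesis using pade_error_laurent[OF red] by simp
  qed
qed

end
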